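(* For all $k,l\in\{1,\ldots,M\}$ and all $0<\Delta<\tau\le T_M$, the empirical quadratic covariation $$\hat{C}_{kl}(\Delta,\tau)=\sum_{i=1}^{\lfloor \tau/\Delta\rfloor}\left(f_{k,i\Delta}-f_{k,(i-1)\Delta}\right)\left(f_{l,i\Delta}-f_{l,(i-1)\Delta}\right)$$ satisfies $$\mathbb{E}\left(\hat{C}_{kl}(\Delta,\tau)\right)=2\int_K y^2\,\nu(dy)\int_0^{\Delta\lfloor \tau/\Delta\rfloor}\left(\mu_c+\mu\,\delta_{kl}\right)e^{-\kappa\left(\max(T_k,T_l)-s\right)}\,\mathbf{1}_{s\le\min(T_k,T_l)}\,ds,$$ where $\delta_{kl}$ is the Kronecker delta.
   Context: Let $M\ge 1$ be an integer and $0<T_1<T_2<\cdots<T_M$ (maturities). Let $K\subset\mathbb{R}_+$ with $\sigma$-algebra $\mathcal{K}$, and let $\nu$ be a probability measure on $(K,\mathcal{K})$ with $\nu(\{0\})=0$ and $\int_K y^2\,\nu(dy)<\infty$. On a probability space $(\Omega,\mathcal{F},\mathbb{P})$ let $\pi_1^+,\ldots,\pi_M^+,\pi_1^-,\ldots,\pi_M^-,\pi^+,\pi^-$ be $2(M+1)$ independent Poisson random measures on $\mathbb{R}_+\times\mathbb{R}_+\times K$, all with intensity measure $ds\otimes dx\otimes\nu(dy)$. Let $\mu,\mu_c,\kappa\ge 0$. For $h\in\{+,-\}$, $m=1,\ldots,M$, $0\le t\le T_M$, define $$f_{m,t}^{h} = \int_0^t\!\int_{\mathbb{R}_+}\!\int_K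 y\,\mathbf{1}_{x \leq \mu e^{-\kappa(T_m-s)} \mathbf{1}_{s \leq T_m}}\, \pi^{h}_m(ds,dx,dy) + \int_0^t\!\int_{\mathbb{R}_+}\!\int_K y\,\mathbf{1}_{x \leq \mu_c e^{-\kappa(T_m-s)}\mathbf{1}_{s \leq T_m}}\, \pi^{h}(ds,dx,dy),$$ and the price of maturity $T_m$ by $f_{m,t}=f_{m,0}+f_{m,t}^+-f_{m,t}^-$, where $f_{m,0}\in\mathbb{R}$ is a deterministic initial price. *)

theory Defs
  imports "HOL-Probability.Probability"
begin

text \<open>
  A Poisson random measure with intensity \<^term>\<open>L\<close>. The count of a set of finite intensity is Poisson
  distributed; the probability weights are written out because \<^const>\<open>poisson_pmf\<close> does not cover
  rate zero. A Poisson variable with infinite mean is, as usual, almost surely infinite.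
\<close>

definition poisson_random_measure ::
    "'w measure \<Rightarrow> 'e measure \<Rightarrow> ('w \<Rightarrow> 'e measure) \<Rightarrow> bool" where
  "poisson_random_measure P L N \<longleftrightarrow>
     (\<forall>w\<in>space P. sets (N w) = sets L) \<and>
     (\<forall>A\<in>sets L. (\<lambda>w. emeasure (N w) A) \<in> borel_measurable P) \<and>
     (\<forall>A\<in>sets L. emeasure L A < \<infinity> \<longrightarrow>
        (\<forall>n::nat. measure P {w \<in> space P. emeasure (N w) A = of_nat n} =
           exp (- measure L A) * measure L A ^ n / fact n)) \<and>
     (\<forall>A\<in>sets L. emeasure L A = \<infinity> \<longrightarrow> (AE w in P. emeasure (N w) A = \<infinity>)) \<and>
     (\<forall>(A :: nat \<Rightarrow> 'e set) n. A ` {..<n} \<subseteq> sets L \<and> disjoint_family_on A {..<n} \<longrightarrow>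
        prob_space.indep_vars P (\<lambda>_. borel) (\<lambda>i w. emeasure (N w) (A i)) {..<n})"

definition random_measure_events ::
    "'w measure \<Rightarrow> 'e measure \<Rightarrow> ('w \<Rightarrow> 'e measure) \<Rightarrow> 'w set set" where
  "random_measure_events P L N =
     sigma_sets (space P)
       {(\<lambda>w. emeasure (N w) A) -` B \<inter> space P | A B. A \<in> sets L \<and> B \<in> sets borel}"

definition independent_random_measures ::
    "'w measure \<Rightarrow> 'e measure \<Rightarrow> ('i \<Rightarrow> 'w \<Rightarrow> 'e measure) \<Rightarrow> 'i set \<Rightarrow> bool" where
  "independent_random_measures P L N I \<longleftrightarrow>
     prob_space.indep_sets P (\<lambda>i. random_measure_events P L (N i)) I"

definition intensity :: "real measure \<Rightarrow> (real \<times> real \<times> real) measure" where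
  "intensity \<nu> = restrict_space lborel {0..} \<Otimes>\<^sub>M (restrict_space lborel {0..} \<Otimes>\<^sub>M \<nu>)"

datatype side = Up | Down

text \<open>
  \<^term>\<open>Specific h m\<close> labels the random measure that drives maturity \<open>m\<close> only, and
  \<^term>\<open>Common h\<close> the one shared by all maturities.
\<close>

datatype driver = Common side | Specific side nat

definition drivers :: "nat \<Rightarrow> driver set" where
  "drivers M = range Common \<union> {Specific h m | h m. m \<in> {1..M}}"

text \<open>
  The time integral is over \<open>(0, t]\<close>, so that it vanishes at \<open>t = 0\<close>. Should the integral be infinite
  (an event of probability zero for the measures considered), its value is \<open>0\<close>.
\<close>

definition jump_integral ::
    "(real \<times> real \<times> real) measure \<Rightarrow> real \<Rightarrow> real \<Rightarrow> real \<Rightarrow> real \<Rightarrow> real" where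
  "jump_integral R a \<kappa> S t =
     (\<integral>(s, x, y). indicator {0<..t} s *
        (y * of_bool (x \<le> a * exp (- \<kappa> * (S - s)) * of_bool (s \<le> S))) \<partial>R)"

definition price_side ::
    "real \<Rightarrow> real \<Rightarrow> real \<Rightarrow> (nat \<Rightarrow> real) \<Rightarrow> (driver \<Rightarrow> 'w \<Rightarrow> (real \<times> real \<times> real) measure) \<Rightarrow>
     side \<Rightarrow> nat \<Rightarrow> real \<Rightarrow> 'w \<Rightarrow> real" where
  "price_side \<mu> \<mu>c \<kappa> T N h m t w =
     jump_integral (N (Specific h m) w) \<mu> \<kappa> (T m) t +
     jump_integral (N (Common h) w) \<mu>c \<kappa> (T m) t"

definition price ::
    "real \<Rightarrow> real \<Rightarrow> real \<Rightarrow> (nat \<Rightarrow> real) \<Rightarrow> (nat \<Rightarrow> real) \<Rightarrow>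
     (driver \<Rightarrow> 'w \<Rightarrow> (real \<times> real \<times> real) measure) \<Rightarrow> nat \<Rightarrow> real \<Rightarrow> 'w \<Rightarrow> real" where
  "price \<mu> \<mu>c \<kappa> T f0 N m t w =
     f0 m + price_side \<mu> \<mu>c \<kappa> T N Up m t w - price_side \<mu> \<mu>c \<kappa> T N Down m t w"

definition quad_covariation ::
    "(nat \<Rightarrow> real \<Rightarrow> 'w \<Rightarrow> real) \<Rightarrow> nat \<Rightarrow> nat \<Rightarrow> real \<Rightarrow> real \<Rightarrow> 'w \<Rightarrow> real" where
  "quad_covariation f k l \<Delta> \<tau> w =
     (\<Sum>i = 1..nat \<lfloor>\<tau> / \<Delta>\<rfloor>.
        (f k (real i * \<Delta>) w - f k ((real i - 1) * \<Delta>) w) *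
        (f l (real i * \<Delta>) w - f l ((real i - 1) * \<Delta>) w))"

end

(*
  For a Poisson random measure N with intensity L, E[N(A) N(B)] = L(A \<inter> B) + L(A) L(B); for two
  independent ones the first summand is absent. Both sides are bilinear under monotone limits, so the
  same holds for integrals: E[(\<integral>f dN)(\<integral>g dN)] = \<integral>fg dL + \<integral>f dL \<integral>g dL. A price increment over (s, t] is a
  sum of such integrals over the up drivers minus the same sum over the down drivers. In the product
  of two increments the products of means cancel, and what survives is a covariance for each driver
  the two maturities share. The region x \<le> rate of T_k and x \<le> rate of T_l is x \<le> the smaller rate, which
  produces exp(-\<kappa>(max(T_k,T_l) - s)) up to time min(T_k,T_l). Summing over the grid, the time
  integrals concatenate.
*)

theory Submission
  imports Defs
begin

section \<open>Moments of Poisson variables\<close>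

text \<open>The weights satisfy (n + 1) p(n + 1) = r p(n). Each moment series, shifted by one, is
  therefore \<open>r\<close> times a sum of lower ones, and the shift loses nothing because the term
  at n = 0 vanishes.\<close>

lemma poisson_weights_sums:
  fixes r :: real
  shows "(\<lambda>n. exp (- r) * r ^ n / fact n) sums 1"
    and "(\<lambda>n. real n * (exp (- r) * r ^ n / fact n)) sums r"
    and "(\<lambda>n. (real n * real n) * (exp (- r) * r ^ n / fact n)) sums (r + r * r)"
proof -
  define p where "p n = exp (- r) * r ^ n / fact n" for n
  have "(\<lambda>n. exp (- r) * (r ^ n /\<^sub>R fact n)) sums (exp (- r) * exp r)"
    by (rule sums_mult[OF exp_converges])
  moreover have "exp (- r) * exp r = 1"
    by (simp add: exp_minus)
  moreover have "exp (- r) * (r ^ n /\<^sub>R fact n) = p n" for n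
    by (simp add: p_def field_simps)
  ultimately have p: "p sums 1"
    by simp
  have step: "real (Suc n) * p (Suc n) = r * p n" for n
    by (simp add: p_def del: of_nat_Suc)
  have "(\<lambda>n. real (Suc n) * p (Suc n)) sums r"
    unfolding step using sums_mult[OF p, of r] by simp
  then have m1: "(\<lambda>n. real n * p n) sums r"
    by (subst (asm) sums_Suc_iff) simp
  have step2: "real (Suc n) * real (Suc n) * p (Suc n) = r * (real n * p n) + r * p n" for n
  proof -
    have "real (Suc n) * real (Suc n) * p (Suc n) = real (Suc n) * (r * p n)"
      by (simp only: mult.assoc step)
    then show ?thesis
      by (simp add: algebra_simps)
  qed
  have "(\<lambda>n. real (Suc n) * real (Suc n) * p (Suc n)) sums (r * r + r)"
    unfolding step2 using sums_add[OF sums_mult[OF m1, of r] sums_mult[OF p, of r]] by simp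
  then have m2: "(\<lambda>n. real n * real n * p n) sums (r + r * r)"
    by (subst (asm) sums_Suc_iff) (simp add: add.commute)
  show "(\<lambda>n. exp (- r) * r ^ n / fact n) sums 1"
    "(\<lambda>n. real n * (exp (- r) * r ^ n / fact n)) sums r"
    "(\<lambda>n. (real n * real n) * (exp (- r) * r ^ n / fact n)) sums (r + r * r)"
    using p m1 m2 unfolding p_def[abs_def] by simp_all
qed

text \<open>The weights sum to 1, so \<open>X\<close> is almost surely a natural number, and the
  expectation of h(X) is the series of the values of h against the weights. This is proved once for
  general h, then used for the identity and the square.\<close>

lemma (in prob_space) poisson_moments:
  fixes X :: "'a \<Rightarrow> ennreal" and r :: real
  assumes X [measurable]: "X \<in> borel_measurable M" and r: "0 \<le> r"
    and weights: "\<And>n::nat. prob {w \<in> space M. X w = of_nat n} = exp (- r) * r ^ n / fact n"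
  shows "(\<integral>\<^sup>+w. X w \<partial>M) = ennreal r"
    and "(\<integral>\<^sup>+w. X w * X w \<partial>M) = ennreal (r + r * r)"
proof -
  let ?E = "\<lambda>n::nat. {w \<in> space M. X w = of_nat n}"
  have "(\<lambda>n. prob (?E n)) sums prob (\<Union>n. ?E n)"
    by (rule finite_measure_UNION) (auto simp: disjoint_family_on_def)
  then have "prob (\<Union>n. ?E n) = 1"
    using poisson_weights_sums(1)[of r] weights sums_unique2 by simp
  then have "AE w in M. w \<in> (\<Union>n. ?E n)"
    by (rule AE_prob_1)
  then have range: "AE w in M. \<exists>n::nat. X w = of_nat n"
    by eventually_elim auto
  have moment: "(\<integral>\<^sup>+w. h (X w) \<partial>M) = ennreal c"
    if h [measurable]: "h \<in> borel_measurable borel" and q: "\<And>n. h (of_nat n) = ennreal (q n)" "\<And>n. 0 \<le> q n"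
      and c: "(\<lambda>n. q n * (exp (- r) * r ^ n / fact n)) sums c"
    for h :: "ennreal \<Rightarrow> ennreal" and q :: "nat \<Rightarrow> real" and c
  proof -
    have "(\<integral>\<^sup>+w. h (X w) \<partial>M) = (\<integral>\<^sup>+w. (\<Sum>n. ennreal (q n) * indicator (?E n) w) \<partial>M)"
    proof (rule nn_integral_cong_AE, use range AE_space in eventually_elim)
      fix w assume "\<exists>n::nat. X w = of_nat n" and w: "w \<in> space M"
      then obtain m :: nat where m: "X w = of_nat m" by auto
      \<comment> \<open>At a fixed \<open>w\<close> the events \<open>?E n\<close> exclude each
        other, so the series has a single nonzero term.\<close>
      have "(\<lambda>n. ennreal (q n) * indicator (?E n) w) sums (\<Sum>n\<in>{m}. ennreal (q n) * indicator (?E n) w)"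
        by (rule sums_finite) (auto simp: m split: split_indicator)
      then show "h (X w) = (\<Sum>n. ennreal (q n) * indicator (?E n) w)"
        using w by (simp add: m q sums_unique[symmetric])
    qed
    also have "\<dots> = (\<Sum>n. ennreal (q n) * emeasure M (?E n))"
      by (subst nn_integral_suminf) (simp_all add: nn_integral_cmult)
    also have "\<dots> = (\<Sum>n. ennreal (q n * (exp (- r) * r ^ n / fact n)))"
      using r q(2) by (simp only: emeasure_eq_measure weights) (subst ennreal_mult, simp_all)
    also have "\<dots> = ennreal c"
      using c r q(2) by (intro suminf_ennreal_eq) auto
    finally show ?thesis .
  qed
  show "(\<integral>\<^sup>+w. X w \<partial>M) = ennreal r"
    by (rule moment[of "\<lambda>x. x", OF _ _ _ poisson_weights_sums(2)])
      (simp_all add: ennreal_of_nat_eq_real_of_nat)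
  show "(\<integral>\<^sup>+w. X w * X w \<partial>M) = ennreal (r + r * r)"
    by (rule moment[of "\<lambda>x. x * x", OF _ _ _ poisson_weights_sums(3)])
      (simp_all add: ennreal_of_nat_eq_real_of_nat ennreal_mult)
qed

section \<open>Integrals of functions against random measures\<close>

text \<open>The measurability half of \<open>poisson_random_measure\<close>. Together with a formula
  on sets it is what the passage from sets to functions relies on.\<close>

definition random_measure :: "'w measure \<Rightarrow> 'e measure \<Rightarrow> ('w \<Rightarrow> 'e measure) \<Rightarrow> bool" where
  "random_measure P L N \<longleftrightarrow> (\<forall>w\<in>space P. sets (N w) = sets L) \<and>
     (\<forall>A\<in>sets L. (\<lambda>w. emeasure (N w) A) \<in> borel_measurable P)"

text \<open>\<open>h\<close> is the density with respect to \<open>L\<close> of the measure that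
  sends A to E[N(A) Z]; the formula spreads from sets to nonnegative functions by the standard
  induction. The weight \<open>Z\<close> makes room for a second random measure: Z = 1 yields the
  mean of an integral, and a count or an integral under another measure yields product
  moments.\<close>

lemma random_measure_nn_integral:
  assumes N: "random_measure P L N"
    and Z [measurable]: "Z \<in> borel_measurable P" and h [measurable]: "h \<in> borel_measurable L"
    and base: "\<And>A. A \<in> sets L \<Longrightarrow>
      (\<integral>\<^sup>+w. emeasure (N w) A * Z w \<partial>P) = (\<integral>\<^sup>+e. indicator A e * h e \<partial>L)"
    and f: "f \<in> borel_measurable L"
  shows "(\<lambda>w. \<integral>\<^sup>+e. f e \<partial>N w) \<in> borel_measurable P \<and>
    (\<integral>\<^sup>+w. (\<integral>\<^sup>+e. f e \<partial>N w) * Z w \<partial>P) = (\<integral>\<^sup>+e. f e * h e \<partial>L)"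
proof -
  have sets: "sets (N w) = sets L" if "w \<in> space P" for w
    using N that by (auto simp: random_measure_def)
  have space: "space (N w) = space L" if "w \<in> space P" for w
    using sets[OF that] by (rule sets_eq_imp_space_eq)
  have meas: "u \<in> borel_measurable (N w)" if "w \<in> space P" "u \<in> borel_measurable L"
    for w and u :: "_ \<Rightarrow> ennreal"
    using that(2) by (simp add: measurable_cong_sets[OF sets[OF that(1)] refl])
  \<comment> \<open>The inner integral is rewritten only for \<open>w\<close> in
    \<open>space P\<close>. Each case of the induction supplies the rewritten form \<open>G\<close>,
    and congruence carries measurability and the outer integral over.\<close>
  have transfer: "(\<lambda>w. \<integral>\<^sup>+e. u e \<partial>N w) \<in> borel_measurable P \<and>
      (\<integral>\<^sup>+w. (\<integral>\<^sup>+e. u e \<partial>N w) * Z w \<partial>P) = r"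
    if "\<And>w. w \<in> space P \<Longrightarrow> (\<integral>\<^sup>+e. u e \<partial>N w) = G w" "G \<in> borel_measurable P"
      "(\<integral>\<^sup>+w. G w * Z w \<partial>P) = r" for u G r
    using that by (simp cong: measurable_cong nn_integral_cong)
  from f show ?thesis
  proof (induction rule: borel_measurable_induct)
    case (cong f g)
    have "(\<integral>\<^sup>+e. f e * h e \<partial>L) = (\<integral>\<^sup>+e. g e * h e \<partial>L)"
      using cong(3) by (intro nn_integral_cong) simp
    moreover have "(\<integral>\<^sup>+e. f e \<partial>N w) = (\<integral>\<^sup>+e. g e \<partial>N w)" if "w \<in> space P" for w
      using cong(3) space[OF that] by (intro nn_integral_cong) simp
    ultimately show ?case
      using cong(4) by (intro transfer[where G = "\<lambda>w. \<integral>\<^sup>+e. g e \<partial>N w"]) auto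
  next
    case (set A)
    then show ?case
      using N base[OF set] sets
      by (intro transfer[where G = "\<lambda>w. emeasure (N w) A"]) (auto simp: random_measure_def)
  next
    case (mult u c)
    have [measurable]: "(\<lambda>w. \<integral>\<^sup>+e. u e \<partial>N w) \<in> borel_measurable P" "u \<in> borel_measurable L"
      using mult by auto
    show ?case
    proof (rule transfer)
      show "(\<integral>\<^sup>+e. c * u e \<partial>N w) = c * (\<integral>\<^sup>+e. u e \<partial>N w)" if "w \<in> space P" for w
        using meas[OF that mult(2)] by (rule nn_integral_cmult)
      show "(\<integral>\<^sup>+w. c * (\<integral>\<^sup>+e. u e \<partial>N w) * Z w \<partial>P) = (\<integral>\<^sup>+e. c * u e * h e \<partial>L)"
        using mult(4) by (simp add: mult.assoc nn_integral_cmult)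
    qed simp
  next
    case (add u v)
    have [measurable]: "(\<lambda>w. \<integral>\<^sup>+e. u e \<partial>N w) \<in> borel_measurable P" "u \<in> borel_measurable L"
      "(\<lambda>w. \<integral>\<^sup>+e. v e \<partial>N w) \<in> borel_measurable P" "v \<in> borel_measurable L"
      using add by auto
    show ?case
    proof (rule transfer)
      show "(\<integral>\<^sup>+e. v e + u e \<partial>N w) = (\<integral>\<^sup>+e. v e \<partial>N w) + (\<integral>\<^sup>+e. u e \<partial>N w)"
        if "w \<in> space P" for w
        using that by (intro nn_integral_add meas) auto
      show "(\<integral>\<^sup>+w. ((\<integral>\<^sup>+e. v e \<partial>N w) + (\<integral>\<^sup>+e. u e \<partial>N w)) * Z w \<partial>P) =
          (\<integral>\<^sup>+e. (v e + u e) * h e \<partial>L)"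
        using add.IH by (simp add: distrib_right nn_integral_add)
    qed simp
  next
    case (seq U)
    have [measurable]: "U i \<in> borel_measurable L" "(\<lambda>w. \<integral>\<^sup>+e. U i e \<partial>N w) \<in> borel_measurable P" for i
      using seq by auto
    have sup: "(SUP i. U i) = (\<lambda>e. SUP i. U i e)"
      by (simp add: fun_eq_iff image_comp)
    show ?case
      unfolding sup
    proof (rule transfer)
      show "(\<integral>\<^sup>+e. (SUP i. U i e) \<partial>N w) = (SUP i. \<integral>\<^sup>+e. U i e \<partial>N w)" if "w \<in> space P" for w
        using that seq(3) by (intro nn_integral_monotone_convergence_SUP meas) auto
      \<comment> \<open>The supremum has already left the integral under each \<open>N w\<close>;
        these two chains let it leave the outer integrals under \<open>P\<close> and
        \<open>L\<close> as well.\<close>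
      have incU: "incseq (\<lambda>i w. (\<integral>\<^sup>+e. U i e \<partial>N w) * Z w)"
        using seq(3) by (auto simp: incseq_def le_fun_def intro!: mult_right_mono nn_integral_mono)
      have inch: "incseq (\<lambda>i e. U i e * h e)"
        using seq(3) by (auto simp: incseq_def le_fun_def intro!: mult_right_mono)
      have "(\<integral>\<^sup>+w. (SUP i. \<integral>\<^sup>+e. U i e \<partial>N w) * Z w \<partial>P) = (SUP i. \<integral>\<^sup>+w. (\<integral>\<^sup>+e. U i e \<partial>N w) * Z w \<partial>P)"
        by (subst nn_integral_monotone_convergence_SUP[OF incU, symmetric])
          (simp_all add: SUP_mult_right_ennreal)
      also have "\<dots> = (SUP i. \<integral>\<^sup>+e. U i e * h e \<partial>L)"
        using seq.IH by (intro SUP_cong) auto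
      also have "\<dots> = (\<integral>\<^sup>+e. (SUP i. U i e) * h e \<partial>L)"
        by (subst nn_integral_monotone_convergence_SUP[OF inch, symmetric])
          (simp_all add: SUP_mult_right_ennreal)
      finally show "(\<integral>\<^sup>+w. (SUP i. \<integral>\<^sup>+e. U i e \<partial>N w) * Z w \<partial>P) = (\<integral>\<^sup>+e. (SUP i. U i e) * h e \<partial>L)" .
    qed simp
  qed
qed

text \<open>The preceding lemma is applied once per argument. The constant \<open>c\<close> is 1 for
  a Poisson random measure paired with itself and 0 for two independent ones.\<close>

lemma random_measure_product_moment:
  assumes N1: "random_measure P L N1" and N2: "random_measure P L N2"
    and base: "\<And>A B. A \<in> sets L \<Longrightarrow> B \<in> sets L \<Longrightarrow>
      (\<integral>\<^sup>+w. emeasure (N1 w) A * emeasure (N2 w) B \<partial>P) =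
        c * emeasure L (A \<inter> B) + emeasure L A * emeasure L B"
    and f [measurable]: "f \<in> borel_measurable L" and g [measurable]: "g \<in> borel_measurable L"
  shows "(\<integral>\<^sup>+w. (\<integral>\<^sup>+e. f e \<partial>N1 w) * (\<integral>\<^sup>+e. g e \<partial>N2 w) \<partial>P) =
    c * (\<integral>\<^sup>+e. f e * g e \<partial>L) + (\<integral>\<^sup>+e. f e \<partial>L) * (\<integral>\<^sup>+e. g e \<partial>L)"
proof -
  \<comment> \<open>With \<open>B\<close> fixed, the weight is N2(B), and \<open>base\<close> says
    that the measure sending A to E[N1(A) N2(B)] has density c 1_B + L(B).\<close>
  have 1: "(\<lambda>w. \<integral>\<^sup>+e. f e \<partial>N1 w) \<in> borel_measurable P \<and>
    (\<integral>\<^sup>+w. (\<integral>\<^sup>+e. f e \<partial>N1 w) * emeasure (N2 w) B \<partial>P) =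
      (\<integral>\<^sup>+e. f e * (c * indicator B e + emeasure L B) \<partial>L)" if B [measurable]: "B \<in> sets L" for B
  proof (rule random_measure_nn_integral[OF N1 _ _ _ f])
    fix A assume A [measurable]: "A \<in> sets L"
    have "(\<integral>\<^sup>+e. indicator A e * (c * indicator B e + emeasure L B) \<partial>L) =
      (\<integral>\<^sup>+e. c * indicator (A \<inter> B) e + emeasure L B * indicator A e \<partial>L)"
      by (intro nn_integral_cong) (auto split: split_indicator)
    also have "\<dots> = c * emeasure L (A \<inter> B) + emeasure L A * emeasure L B"
      by (simp add: nn_integral_add nn_integral_cmult nn_integral_cmult_indicator mult.commute[of "emeasure L A"])
    finally show "(\<integral>\<^sup>+w. emeasure (N1 w) A * emeasure (N2 w) B \<partial>P) =
        (\<integral>\<^sup>+e. indicator A e * (c * indicator B e + emeasure L B) \<partial>L)"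
      using base[OF A B] by simp
  qed (use N2 B in \<open>auto simp: random_measure_def\<close>)
  define I where "I = (\<integral>\<^sup>+e. f e \<partial>L)"
  \<comment> \<open>The roles are exchanged: the weight is now the integral of \<open>f\<close>
    under \<open>N1\<close>, the result for fixed \<open>B\<close> acts as the base case, and the
    density becomes c f + I.\<close>
  have "(\<integral>\<^sup>+w. (\<integral>\<^sup>+e. g e \<partial>N2 w) * (\<integral>\<^sup>+e. f e \<partial>N1 w) \<partial>P) = (\<integral>\<^sup>+e. g e * (c * f e + I) \<partial>L)"
  proof (rule conjunct2[OF random_measure_nn_integral[OF N2 _ _ _ g]])
    \<comment> \<open>The measurability part of \<open>1\<close> does not mention the set, so the
      empty set serves as a dummy instance.\<close>
    show "(\<lambda>w. \<integral>\<^sup>+e. f e \<partial>N1 w) \<in> borel_measurable P"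
      using 1[of "{}"] by simp
    fix B assume B [measurable]: "B \<in> sets L"
    have "(\<integral>\<^sup>+e. indicator B e * (c * f e + I) \<partial>L) = c * (\<integral>\<^sup>+e. f e * indicator B e \<partial>L) + I * emeasure L B"
      by (simp add: distrib_left mult_ac nn_integral_add nn_integral_cmult)
    moreover have "(\<integral>\<^sup>+e. f e * (c * indicator B e + emeasure L B) \<partial>L) =
       c * (\<integral>\<^sup>+e. f e * indicator B e \<partial>L) + I * emeasure L B"
      by (simp add: distrib_left mult_ac nn_integral_add nn_integral_cmult nn_integral_multc I_def)
    ultimately show "(\<integral>\<^sup>+w. emeasure (N2 w) B * (\<integral>\<^sup>+e. f e \<partial>N1 w) \<partial>P) =
        (\<integral>\<^sup>+e. indicator B e * (c * f e + I) \<partial>L)"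
      using 1[OF B] by (simp add: mult.commute)
  qed simp
  also have "\<dots> = c * (\<integral>\<^sup>+e. f e * g e \<partial>L) + I * (\<integral>\<^sup>+e. g e \<partial>L)"
    by (simp add: distrib_left mult_ac nn_integral_add nn_integral_cmult)
  finally show ?thesis
    by (simp add: I_def mult.commute)
qed

section \<open>First and second moments of Poisson random measures\<close>

lemma poisson_random_measureD:
  assumes "poisson_random_measure P L N"
  shows "random_measure P L N"
    and "A \<in> sets L \<Longrightarrow> emeasure L A < \<infinity> \<Longrightarrow>
      measure P {w \<in> space P. emeasure (N w) A = of_nat n} = exp (- measure L A) * measure L A ^ n / fact n"
    and "A \<in> sets L \<Longrightarrow> emeasure L A = \<infinity> \<Longrightarrow> AE w in P. emeasure (N w) A = \<infinity>"
    and "B ` {..<n} \<subseteq> sets L \<Longrightarrow> disjoint_family_on B {..<n} \<Longrightarrow>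
      prob_space.indep_vars P (\<lambda>_. borel) (\<lambda>i w. emeasure (N w) (B i)) {..<n}"
  using assms unfolding poisson_random_measure_def random_measure_def by simp_all

lemma (in prob_space) indep_vars_nn_integral_mult:
  fixes X :: "'i \<Rightarrow> 'a \<Rightarrow> ennreal"
  assumes "indep_vars (\<lambda>_. borel) X I" and "i \<in> I" "j \<in> I" "i \<noteq> j"
  shows "(\<integral>\<^sup>+w. X i w * X j w \<partial>M) = (\<integral>\<^sup>+w. X i w \<partial>M) * (\<integral>\<^sup>+w. X j w \<partial>M)"
proof -
  have "indep_vars (\<lambda>_. borel) X {i, j}"
    using assms by (intro indep_vars_subset[OF assms(1)]) auto
  from indep_vars_nn_integral[OF _ this] assms(4) show ?thesis
    by simp
qed

context prob_space
begin

text \<open>For finite intensity this is the first Poisson moment. For infinite intensity the count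
  is almost surely infinite, and both sides are infinite. The second moment below splits in the same
  way.\<close>

lemma poisson_random_measure_mean:
  assumes N: "poisson_random_measure M L N" and A: "A \<in> sets L"
  shows "(\<integral>\<^sup>+w. emeasure (N w) A \<partial>M) = emeasure L A"
proof -
  note D = poisson_random_measureD[OF N]
  have m [measurable]: "(\<lambda>w. emeasure (N w) A) \<in> borel_measurable M"
    using D(1) A by (auto simp: random_measure_def)
  show ?thesis
  proof (cases "emeasure L A = \<infinity>")
    case True
    then have "(\<integral>\<^sup>+w. emeasure (N w) A \<partial>M) = (\<integral>\<^sup>+w. \<infinity> \<partial>M)"
      using D(3)[OF A] by (intro nn_integral_cong_AE) auto
    then show ?thesis
      using True by (simp add: emeasure_space_1)
  next
    case False
    then show ?thesis
      using poisson_moments(1)[OF m measure_nonneg D(2)[OF A]]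
      by (simp add: emeasure_eq_ennreal_measure top.not_eq_extremum)
  qed
qed

lemma poisson_random_measure_second_moment:
  assumes N: "poisson_random_measure M L N" and A: "A \<in> sets L"
  shows "(\<integral>\<^sup>+w. emeasure (N w) A * emeasure (N w) A \<partial>M) = emeasure L A + emeasure L A * emeasure L A"
proof -
  note D = poisson_random_measureD[OF N]
  have m [measurable]: "(\<lambda>w. emeasure (N w) A) \<in> borel_measurable M"
    using D(1) A by (auto simp: random_measure_def)
  show ?thesis
  proof (cases "emeasure L A = \<infinity>")
    case True
    then have "(\<integral>\<^sup>+w. emeasure (N w) A * emeasure (N w) A \<partial>M) = (\<integral>\<^sup>+w. \<infinity> \<partial>M)"
      using D(3)[OF A] by (intro nn_integral_cong_AE) auto
    then show ?thesis
      using True by (simp add: emeasure_space_1)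
  next
    case False
    then show ?thesis
      using poisson_moments(2)[OF m measure_nonneg D(2)[OF A]]
      by (simp add: emeasure_eq_ennreal_measure top.not_eq_extremum ennreal_mult)
  qed
qed

lemma poisson_random_measure_disjoint_moment:
  assumes N: "poisson_random_measure M L N" and A: "A \<in> sets L" and B: "B \<in> sets L" and "A \<inter> B = {}"
  shows "(\<integral>\<^sup>+w. emeasure (N w) A * emeasure (N w) B \<partial>M) = emeasure L A * emeasure L B"
proof -
  \<comment> \<open>Independence over disjoint sets is stated for families indexed by
    \<open>{..<n}\<close>; \<open>C\<close> puts the pair into that form with n = 2.\<close>
  define C where "C i = (if i = 0 then A else B)" for i :: nat
  have "indep_vars (\<lambda>_. borel) (\<lambda>i w. emeasure (N w) (C i)) {..<2}"
    using assms by (intro poisson_random_measureD(4)[OF N]) (auto simp: C_def disjoint_family_on_def)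
  from indep_vars_nn_integral_mult[OF this, of 0 1] show ?thesis
    using poisson_random_measure_mean[OF N] A B by (simp add: C_def)
qed

text \<open>Both sets are cut along their intersection. Of the four products of counts, three
  involve disjoint sets and factor by independence; the square of the count of the intersection adds
  its own intensity.\<close>

lemma poisson_random_measure_set_product_moment:
  assumes N: "poisson_random_measure M L N" and A: "A \<in> sets L" and B: "B \<in> sets L"
  shows "(\<integral>\<^sup>+w. emeasure (N w) A * emeasure (N w) B \<partial>M) = emeasure L (A \<inter> B) + emeasure L A * emeasure L B"
proof -
  note D = poisson_random_measureD(1)[OF N, unfolded random_measure_def]
  have [measurable]: "(\<lambda>w. emeasure (N w) C) \<in> borel_measurable M" if "C \<in> sets L" for C
    using D that by auto
  let ?C = "A \<inter> B" and ?A = "A - B" and ?B = "B - A"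
  have C: "?C \<in> sets L" "?A \<in> sets L" "?B \<in> sets L"
    using A B by auto
  have split: "emeasure m A = emeasure m ?C + emeasure m ?A" "emeasure m B = emeasure m ?C + emeasure m ?B"
    if "sets m = sets L" for m
  proof -
    have "?C \<union> ?A = A" "?C \<union> ?B = B" "?C \<inter> ?A = {}" "?C \<inter> ?B = {}" by auto
    then show "emeasure m A = emeasure m ?C + emeasure m ?A" "emeasure m B = emeasure m ?C + emeasure m ?B"
      using plus_emeasure[of ?C m ?A] plus_emeasure[of ?C m ?B] C that by auto
  qed
  have expand: "(x + y) * (x + z) = (x * x + x * z) + (y * x + y * z)" for x y z :: ennreal
    by (simp add: distrib_left distrib_right ac_simps)
  have disj: "?C \<inter> ?B = {}" "?A \<inter> ?C = {}" "?A \<inter> ?B = {}"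
    by auto
  note moments = poisson_random_measure_second_moment[OF N C(1)]
    poisson_random_measure_disjoint_moment[OF N C(1) C(3) disj(1)]
    poisson_random_measure_disjoint_moment[OF N C(2) C(1) disj(2)]
    poisson_random_measure_disjoint_moment[OF N C(2) C(3) disj(3)]
  have "(\<integral>\<^sup>+w. emeasure (N w) A * emeasure (N w) B \<partial>M) =
      (\<integral>\<^sup>+w. (emeasure (N w) ?C * emeasure (N w) ?C + emeasure (N w) ?C * emeasure (N w) ?B) +
        (emeasure (N w) ?A * emeasure (N w) ?C + emeasure (N w) ?A * emeasure (N w) ?B) \<partial>M)"
    using D by (intro nn_integral_cong) (subst split, simp, subst split, simp, simp only: expand)
  also have "\<dots> = (emeasure L ?C + emeasure L ?C * emeasure L ?C + emeasure L ?C * emeasure L ?B) +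
      (emeasure L ?A * emeasure L ?C + emeasure L ?A * emeasure L ?B)"
    using C by (simp add: nn_integral_add moments)
  \<comment> \<open>Apart from the extra \<open>emeasure L ?C\<close>, the intensities form the same
    four products as the counts did, so \<open>expand\<close> is read backwards.\<close>
  also have "\<dots> = emeasure L ?C + (emeasure L ?C + emeasure L ?A) * (emeasure L ?C + emeasure L ?B)"
    by (simp only: expand add.assoc)
  also have "\<dots> = emeasure L ?C + emeasure L A * emeasure L B"
    by (simp only: split[OF refl, symmetric])
  finally show ?thesis .
qed

text \<open>Independence is given for the sigma-algebras generated by all counts of each measure. A
  single count is measurable for its own sigma-algebra, so two such counts are independent variables
  and their means multiply.\<close>

lemma independent_random_measures_set_product_moment:
  assumes indep: "independent_random_measures M L N I" and d: "d \<in> I" "e \<in> I" "d \<noteq> e"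
    and N: "poisson_random_measure M L (N d)" "poisson_random_measure M L (N e)"
    and A: "A \<in> sets L" and B: "B \<in> sets L"
  shows "(\<integral>\<^sup>+w. emeasure (N d w) A * emeasure (N e w) B \<partial>M) = emeasure L A * emeasure L B"
proof -
  define X where "X i w = emeasure (N i w) (if i = d then A else B)" for i w
  have X [measurable]: "X i \<in> borel_measurable M" if "i \<in> {d, e}" for i
    using that A B N[THEN poisson_random_measureD(1)] by (auto simp: X_def[abs_def] random_measure_def)
  have "indep_sets (\<lambda>i. random_measure_events M L (N i)) {d, e}"
    using indep d unfolding independent_random_measures_def
    by (elim indep_sets_mono_index[rotated]) simp
  then have "indep_sets (\<lambda>i. {X i -` C \<inter> space M | C. C \<in> sets borel}) {d, e}"
  proof (rule indep_sets_mono_sets)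
    fix i
    have "(if i = d then A else B) \<in> sets L"
      using A B by simp
    then show "{X i -` C \<inter> space M | C. C \<in> sets borel} \<subseteq> random_measure_events M L (N i)"
      unfolding random_measure_events_def X_def by (blast intro: sigma_sets.Basic)
  qed
  then have "indep_vars (\<lambda>_. borel) X {d, e}"
    unfolding indep_vars_def2 using X by simp
  from indep_vars_nn_integral_mult[OF this, of d e] show ?thesis
    using d poisson_random_measure_mean[OF N(1) A] poisson_random_measure_mean[OF N(2) B] by (simp add: X_def)
qed

text \<open>Campbell's formula: the general induction with weight 1 and density 1.\<close>

lemma poisson_random_measure_nn_integral:
  assumes N: "poisson_random_measure M L N" and f: "f \<in> borel_measurable L"
  shows "(\<lambda>w. \<integral>\<^sup>+e. f e \<partial>N w) \<in> borel_measurable M"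
    and "(\<integral>\<^sup>+w. (\<integral>\<^sup>+e. f e \<partial>N w) \<partial>M) = (\<integral>\<^sup>+e. f e \<partial>L)"
proof -
  have "(\<integral>\<^sup>+w. emeasure (N w) A * 1 \<partial>M) = (\<integral>\<^sup>+e. indicator A e * 1 \<partial>L)" if "A \<in> sets L" for A
    using poisson_random_measure_mean[OF N that] that by simp
  then have *: "(\<lambda>w. \<integral>\<^sup>+e. f e \<partial>N w) \<in> borel_measurable M \<and>
      (\<integral>\<^sup>+w. (\<integral>\<^sup>+e. f e \<partial>N w) * 1 \<partial>M) = (\<integral>\<^sup>+e. f e * 1 \<partial>L)"
    by (intro random_measure_nn_integral[OF poisson_random_measureD(1)[OF N] _ _ _ f]) simp_all
  show "(\<lambda>w. \<integral>\<^sup>+e. f e \<partial>N w) \<in> borel_measurable M"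
    using * by (rule conjunct1)
  show "(\<integral>\<^sup>+w. (\<integral>\<^sup>+e. f e \<partial>N w) \<partial>M) = (\<integral>\<^sup>+e. f e \<partial>L)"
    using conjunct2[OF *] by (simp only: mult_1_right)
qed

text \<open>A finite mean excludes the value infinity almost surely. This is what keeps
  \<open>enn2real\<close>, which sends infinity to 0, from falsifying the real-valued
  formulas.\<close>

lemma AE_poisson_random_measure_nn_integral_finite:
  assumes N: "poisson_random_measure M L N" and f: "f \<in> borel_measurable L" and "(\<integral>\<^sup>+e. f e \<partial>L) < \<infinity>"
  shows "AE w in M. (\<integral>\<^sup>+e. f e \<partial>N w) \<noteq> \<infinity>"
proof (rule nn_integral_noteq_infinite)
  show "(\<integral>\<^sup>+w. (\<integral>\<^sup>+e. f e \<partial>N w) \<partial>M) \<noteq> \<infinity>"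
    using assms(3) by (simp add: poisson_random_measure_nn_integral(2)[OF N f])
qed (rule poisson_random_measure_nn_integral(1)[OF N f])

text \<open>Covers equal and distinct drivers at once: \<open>of_bool (d = e)\<close> is the
  constant of the general product formula. The value \<open>c\<close> of the mixed integral is
  prescribed only for equal drivers, as its coefficient is 0 otherwise.\<close>

lemma poisson_random_measures_product_moment:
  fixes f g :: "'e \<Rightarrow> ennreal"
  assumes N: "\<And>i. i \<in> I \<Longrightarrow> poisson_random_measure M L (N i)" and indep: "independent_random_measures M L N I"
    and d: "d \<in> I" "e \<in> I"
    and f: "f \<in> borel_measurable L" and g: "g \<in> borel_measurable L"
    and m: "(\<integral>\<^sup>+z. f z \<partial>L) = ennreal p" "(\<integral>\<^sup>+z. g z \<partial>L) = ennreal q" "0 \<le> p" "0 \<le> q"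
    and c: "d = e \<Longrightarrow> (\<integral>\<^sup>+z. f z * g z \<partial>L) = ennreal c" "0 \<le> c"
  shows "has_bochner_integral M (\<lambda>w. enn2real (\<integral>\<^sup>+z. f z \<partial>N d w) * enn2real (\<integral>\<^sup>+z. g z \<partial>N e w))
    (of_bool (d = e) * c + p * q)"
proof -
  note R = N[THEN poisson_random_measureD(1)]
  have "(\<integral>\<^sup>+w. (\<integral>\<^sup>+z. f z \<partial>N d w) * (\<integral>\<^sup>+z. g z \<partial>N e w) \<partial>M) =
      of_bool (d = e) * (\<integral>\<^sup>+z. f z * g z \<partial>L) + (\<integral>\<^sup>+z. f z \<partial>L) * (\<integral>\<^sup>+z. g z \<partial>L)"
  proof (rule random_measure_product_moment[OF R[OF d(1)] R[OF d(2)] _ f g])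
    fix A B assume "A \<in> sets L" "B \<in> sets L"
    then show "(\<integral>\<^sup>+w. emeasure (N d w) A * emeasure (N e w) B \<partial>M) =
        of_bool (d = e) * emeasure L (A \<inter> B) + emeasure L A * emeasure L B"
      using poisson_random_measure_set_product_moment[OF N[OF d(2)]]
        independent_random_measures_set_product_moment[OF indep d _ N[OF d(1)] N[OF d(2)]]
      by (cases "d = e") simp_all
  qed
  also have "\<dots> = ennreal (of_bool (d = e) * c + p * q)"
    using m c by (simp add: ennreal_mult)
  finally have int: "(\<integral>\<^sup>+w. (\<integral>\<^sup>+z. f z \<partial>N d w) * (\<integral>\<^sup>+z. g z \<partial>N e w) \<partial>M) = ennreal (of_bool (d = e) * c + p * q)" .
  note meas [measurable] = poisson_random_measure_nn_integral(1)[OF N[OF d(1)] f]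
    poisson_random_measure_nn_integral(1)[OF N[OF d(2)] g]
  have "AE w in M. (\<integral>\<^sup>+z. f z \<partial>N d w) \<noteq> \<infinity>" "AE w in M. (\<integral>\<^sup>+z. g z \<partial>N e w) \<noteq> \<infinity>"
    using AE_poisson_random_measure_nn_integral_finite[OF N[OF d(1)] f]
      AE_poisson_random_measure_nn_integral_finite[OF N[OF d(2)] g] m(1,2) by simp_all
  \<comment> \<open>Outside a null set both integrals are finite, so passing to the reals and back
    changes nothing.\<close>
  then have "AE w in M. ennreal (enn2real (\<integral>\<^sup>+z. f z \<partial>N d w) * enn2real (\<integral>\<^sup>+z. g z \<partial>N e w)) =
      (\<integral>\<^sup>+z. f z \<partial>N d w) * (\<integral>\<^sup>+z. g z \<partial>N e w)"
    by eventually_elim (simp add: ennreal_mult top.not_eq_extremum)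
  then have "(\<integral>\<^sup>+w. ennreal (enn2real (\<integral>\<^sup>+z. f z \<partial>N d w) * enn2real (\<integral>\<^sup>+z. g z \<partial>N e w)) \<partial>M) =
      ennreal (of_bool (d = e) * c + p * q)"
    unfolding int[symmetric] by (rule nn_integral_cong_AE)
  then show ?thesis
    using m(3,4) c(2) by (intro has_bochner_integral_nn_integral) simp_all
qed

end

section \<open>Decay factors, jump kernels and integration against the intensity\<close>

text \<open>For S = S' this is the decay factor in the acceptance threshold of one maturity. For two
  maturities it is the factor of the threshold below which an atom moves both prices.\<close>

definition jump_overlap :: "real \<Rightarrow> real \<Rightarrow> real \<Rightarrow> real \<Rightarrow> real" where
  "jump_overlap \<kappa> S S' s = exp (- \<kappa> * (max S S' - s)) * of_bool (s \<le> min S S')"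

text \<open>The integrand of \<open>jump_integral\<close> with an arbitrary time set
  \<open>I\<close>, so that increments over \<open>{t<..t'}\<close> are covered too.\<close>

definition jump_kernel :: "real set \<Rightarrow> real \<Rightarrow> real \<Rightarrow> real \<Rightarrow> real \<times> real \<times> real \<Rightarrow> real" where
  "jump_kernel I a \<kappa> S e =
     indicator I (fst e) * (snd (snd e) * of_bool (fst (snd e) \<le> a * jump_overlap \<kappa> S S (fst e)))"

lemma jump_integral_eq: "jump_integral R a \<kappa> S t = (\<integral>e. jump_kernel {0<..t} a \<kappa> S e \<partial>R)"
  by (simp add: jump_integral_def jump_kernel_def jump_overlap_def case_prod_unfold mult.assoc)

lemma jump_overlap_nonneg: "0 \<le> jump_overlap \<kappa> S S' s"
  by (simp add: jump_overlap_def)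

lemma jump_overlap_le_1: "0 \<le> \<kappa> \<Longrightarrow> jump_overlap \<kappa> S S' s \<le> 1"
  by (auto simp: jump_overlap_def)

lemma measurable_jump_overlap [measurable]: "jump_overlap \<kappa> S S' \<in> borel_measurable borel"
  unfolding jump_overlap_def[abs_def] of_bool_def by measurable

text \<open>For \<kappa> \<ge> 0 the exponential decreases in the maturity, so the later maturity
  gives the smaller factor while both are alive; after the earlier one has expired the minimum is 0.
  Scaling by a \<ge> 0 commutes with the minimum.\<close>

lemma min_jump_overlap:
  assumes "0 \<le> a" "0 \<le> \<kappa>"
  shows "min (a * jump_overlap \<kappa> S S s) (a * jump_overlap \<kappa> S' S' s) = a * jump_overlap \<kappa> S S' s"
proof -
  have mono: "exp (- \<kappa> * (v - s)) \<le> exp (- \<kappa> * (u - s))" if "u \<le> v" for u v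
    using that assms(2) by (simp add: mult_left_mono)
  have "min (jump_overlap \<kappa> S S s) (jump_overlap \<kappa> S' S' s) = jump_overlap \<kappa> S S' s"
    using mono[of S S'] mono[of S' S] by (auto simp: jump_overlap_def min_def max_def)
  then show ?thesis
    using assms(1) by (metis min_mult_distrib_left)
qed

lemma set_integrable_jump_overlap:
  assumes "0 \<le> \<kappa>" "I \<in> sets lborel" "emeasure lborel I < \<infinity>"
  shows "set_integrable lborel I (jump_overlap \<kappa> S S')"
  unfolding set_integrable_def using assms jump_overlap_nonneg jump_overlap_le_1[OF assms(1)]
  by (intro integrableI_bounded_set_indicator[where B = 1]) auto

text \<open>By Tonelli: for fixed s the admissible x fill the interval from 0 to c(s), of length
  c(s), and the mark integral is a constant factor.\<close>

lemma nn_integral_intensity: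
  assumes "prob_space \<nu>" and u [measurable]: "u \<in> borel_measurable \<nu>"
    and c [measurable]: "c \<in> borel_measurable borel" "\<And>s. 0 \<le> c s"
    and I [measurable]: "I \<in> sets borel" "I \<subseteq> {0..}"
  shows "(\<integral>\<^sup>+e. indicator I (fst e) * (u (snd (snd e)) * of_bool (fst (snd e) \<le> c (fst e))) \<partial>intensity \<nu>) =
    (\<integral>\<^sup>+y. u y \<partial>\<nu>) * (\<integral>\<^sup>+s. indicator I s * ennreal (c s) \<partial>lborel)"
proof -
  interpret V: prob_space \<nu> by fact
  let ?R = "restrict_space lborel {0::real..}"
  interpret R: sigma_finite_measure ?R
    by (rule sigma_finite_measure_restrict_space) (auto intro: sigma_finite_lborel)
  interpret RV: pair_sigma_finite ?R \<nu> ..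
  have R: "(\<integral>\<^sup>+x. f x \<partial>?R) = (\<integral>\<^sup>+x. f x * indicator {0..} x \<partial>lborel)" for f :: "real \<Rightarrow> ennreal"
    by (rule nn_integral_restrict_space) simp
  have [measurable]: "(\<lambda>s. s) \<in> ?R \<rightarrow>\<^sub>M borel"
    by (rule measurable_restrict_space1) simp
  have "(\<integral>\<^sup>+e. indicator I (fst e) * (u (snd (snd e)) * of_bool (fst (snd e) \<le> c (fst e))) \<partial>intensity \<nu>) =
      (\<integral>\<^sup>+s. \<integral>\<^sup>+x. \<integral>\<^sup>+y. indicator I s * (u y * of_bool (x \<le> c s)) \<partial>\<nu> \<partial>?R \<partial>?R)"
    unfolding intensity_def of_bool_def
    by (simp add: RV.P.nn_integral_fst[symmetric] V.nn_integral_fst[symmetric])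
  also have "\<dots> = (\<integral>\<^sup>+s. indicator I s * ((\<integral>\<^sup>+y. u y \<partial>\<nu>) * ennreal (c s)) \<partial>?R)"
  proof (rule nn_integral_cong)
    fix s
    have "(\<integral>\<^sup>+x. \<integral>\<^sup>+y. indicator I s * (u y * of_bool (x \<le> c s)) \<partial>\<nu> \<partial>?R) =
        (\<integral>\<^sup>+x. indicator I s * (\<integral>\<^sup>+y. u y \<partial>\<nu>) * indicator {0..c s} x \<partial>lborel)"
      unfolding R by (intro nn_integral_cong)
        (auto simp: nn_integral_cmult nn_integral_multc split: split_indicator)
    also have "\<dots> = indicator I s * ((\<integral>\<^sup>+y. u y \<partial>\<nu>) * ennreal (c s))"
      using c(2)[of s] by (subst nn_integral_cmult_indicator) (simp_all add: mult.assoc)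
    finally show "(\<integral>\<^sup>+x. \<integral>\<^sup>+y. indicator I s * (u y * of_bool (x \<le> c s)) \<partial>\<nu> \<partial>?R) =
        indicator I s * ((\<integral>\<^sup>+y. u y \<partial>\<nu>) * ennreal (c s))" .
  qed
  \<comment> \<open>The restriction of time to the half-line disappears because \<open>I\<close>
    lies inside it.\<close>
  also have "\<dots> = (\<integral>\<^sup>+s. (\<integral>\<^sup>+y. u y \<partial>\<nu>) * (indicator I s * ennreal (c s)) \<partial>lborel)"
    unfolding R using I(2) by (intro nn_integral_cong) (auto simp: ac_simps split: split_indicator)
  also have "\<dots> = (\<integral>\<^sup>+y. u y \<partial>\<nu>) * (\<integral>\<^sup>+s. indicator I s * ennreal (c s) \<partial>lborel)"
    by (rule nn_integral_cmult) simp
  finally show ?thesis .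
qed

text \<open>Turns an integral assembled by linearity into the desired form, leaving two purely
  algebraic goals, one for the function and one for the value.\<close>

lemma has_bochner_integral_transfer:
  assumes "has_bochner_integral M f x" "\<And>w. f w = g w" "x = y"
  shows "has_bochner_integral M g y"
proof -
  have "f = g"
    using assms(2) by (rule ext)
  then show ?thesis
    using assms(1,3) by simp
qed

section \<open>Moments of the jumps of single drivers\<close>

locale jump_driven_curve = prob_space P for P :: "'w measure" +
  fixes \<nu> :: "real measure" and N :: "driver \<Rightarrow> 'w \<Rightarrow> (real \<times> real \<times> real) measure"
    and M :: nat and T f0 :: "nat \<Rightarrow> real" and \<mu> \<mu>c \<kappa> :: real
  assumes prob_mark: "prob_space \<nu>" and mark_nonneg: "space \<nu> \<subseteq> {0..}"
    and mark_square: "integrable \<nu> (\<lambda>y. y\<^sup>2)"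
    and poisson: "d \<in> drivers M \<Longrightarrow> poisson_random_measure P (intensity \<nu>) (N d)"
    and independent: "independent_random_measures P (intensity \<nu>) N (drivers M)"
    and nonneg: "0 \<le> \<mu>" "0 \<le> \<mu>c" "0 \<le> \<kappa>"
begin

interpretation V: prob_space \<nu>
  by (rule prob_mark)

definition overlap :: "real set \<Rightarrow> real \<Rightarrow> real \<Rightarrow> real" where
  "overlap I S S' = (LINT s:I|lborel. jump_overlap \<kappa> S S' s)"

text \<open>Defined through the nonnegative integral, so that the moment formulas in
  \<open>ennreal\<close> apply; \<open>jump_integral_eq_jumps\<close> identifies it with the Bochner
  integral.\<close>

definition jumps :: "real set \<Rightarrow> real \<Rightarrow> real \<Rightarrow> driver \<Rightarrow> 'w \<Rightarrow> real" where
  "jumps I a S d w = enn2real (\<integral>\<^sup>+e. ennreal (jump_kernel I a \<kappa> S e) \<partial>N d w)"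

text \<open>The sigma-algebra of \<nu> is not tied to the Borel sets, so measurability of the mark
  is recovered from that of its square: on the nonnegative mark space y is the square root of
  \<open>y\<^sup>2\<close>.\<close>

lemma measurable_mark [measurable]: "(\<lambda>y. y) \<in> borel_measurable \<nu>"
proof -
  have [measurable]: "(\<lambda>y. y\<^sup>2) \<in> borel_measurable \<nu>"
    using mark_square by (rule borel_measurable_integrable)
  have "(\<lambda>y. sqrt (y\<^sup>2)) \<in> borel_measurable \<nu>"
    by measurable
  then show ?thesis
    using mark_nonneg by (subst measurable_cong[where g = "\<lambda>y. sqrt (y\<^sup>2)"]) auto
qed

text \<open>The mark is dominated by \<open>1 + y\<^sup>2\<close>, which is integrable since \<nu>
  is finite; the bound comes from the square of |y| - 1 being nonnegative.\<close>

lemma integrable_mark: "integrable \<nu> (\<lambda>y. y)"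
proof (rule Bochner_Integration.integrable_bound)
  show "integrable \<nu> (\<lambda>y. 1 + y\<^sup>2)"
    using mark_square by simp
  have "\<bar>y\<bar> \<le> 1 + y\<^sup>2" for y :: real
    using zero_le_power2[of "\<bar>y\<bar> - 1"] by (simp add: power2_eq_square algebra_simps)
  then show "AE y in \<nu>. norm y \<le> norm (1 + y\<^sup>2)"
    by (intro AE_I2) simp
qed simp

lemma space_intensityD: "e \<in> space (intensity \<nu>) \<Longrightarrow> 0 \<le> snd (snd e)"
  using mark_nonneg by (auto simp: intensity_def space_pair_measure)

lemma measurable_jump_kernel [measurable]:
  assumes [measurable]: "I \<in> sets borel"
  shows "jump_kernel I a \<kappa> S \<in> borel_measurable (intensity \<nu>)"
proof -
  have [measurable]: "(\<lambda>s. s) \<in> restrict_space lborel {0::real..} \<rightarrow>\<^sub>M borel"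
    by (rule measurable_restrict_space1) simp
  show ?thesis
    unfolding jump_kernel_def[abs_def] intensity_def of_bool_def by measurable
qed

lemma jump_kernel_nonneg: "e \<in> space (intensity \<nu>) \<Longrightarrow> 0 \<le> jump_kernel I a \<kappa> S e"
  using space_intensityD by (simp add: jump_kernel_def)

lemma nn_integral_overlap:
  assumes "I \<in> sets borel" "emeasure lborel I < \<infinity>" "0 \<le> a"
  shows "(\<integral>\<^sup>+s. indicator I s * ennreal (a * jump_overlap \<kappa> S S' s) \<partial>lborel) = ennreal (a * overlap I S S')"
proof -
  have "(\<integral>\<^sup>+s. indicator I s * ennreal (a * jump_overlap \<kappa> S S' s) \<partial>lborel) =
      (\<integral>\<^sup>+s. ennreal (a * (indicator I s *\<^sub>R jump_overlap \<kappa> S S' s)) \<partial>lborel)"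
    by (intro nn_integral_cong) (simp split: split_indicator)
  also have "\<dots> = ennreal (\<integral>s. a * (indicator I s *\<^sub>R jump_overlap \<kappa> S S' s) \<partial>lborel)"
    using set_integrable_jump_overlap[OF nonneg(3), of I S S'] assms jump_overlap_nonneg
    by (intro nn_integral_eq_integral) (auto simp: set_integrable_def)
  also have "\<dots> = ennreal (a * overlap I S S')"
    by (simp add: overlap_def set_lebesgue_integral_def)
  finally show ?thesis .
qed

lemma overlap_nonneg: "0 \<le> overlap I S S'"
  unfolding overlap_def set_lebesgue_integral_def using jump_overlap_nonneg
  by (intro Bochner_Integration.integral_nonneg) simp

lemma nn_integral_jump_kernel:
  assumes I: "I \<in> sets borel" "emeasure lborel I < \<infinity>" "I \<subseteq> {0..}" and "0 \<le> a"
  shows "(\<integral>\<^sup>+e. ennreal (jump_kernel I a \<kappa> S e) \<partial>intensity \<nu>) = ennreal ((\<integral>y. y \<partial>\<nu>) * (a * overlap I S S))"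
proof -
  have "(\<integral>\<^sup>+e. ennreal (jump_kernel I a \<kappa> S e) \<partial>intensity \<nu>) =
      (\<integral>\<^sup>+e. indicator I (fst e) * (ennreal (snd (snd e)) *
         of_bool (fst (snd e) \<le> a * jump_overlap \<kappa> S S (fst e))) \<partial>intensity \<nu>)"
    by (intro nn_integral_cong) (simp add: jump_kernel_def split: split_indicator)
  also have "\<dots> = (\<integral>\<^sup>+y. ennreal y \<partial>\<nu>) * ennreal (a * overlap I S S)"
    by (subst nn_integral_intensity[OF prob_mark _ _ _ I(1,3)])
      (simp_all add: nn_integral_overlap[OF I(1,2) assms(4)] assms(4) jump_overlap_nonneg)
  also have "(\<integral>\<^sup>+y. ennreal y \<partial>\<nu>) = ennreal (\<integral>y. y \<partial>\<nu>)"
    using mark_nonneg by (intro nn_integral_eq_integral integrable_mark AE_I2) auto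
  finally show ?thesis
    by (simp only: ennreal_mult''[OF mult_nonneg_nonneg[OF assms(4) overlap_nonneg]])
qed

lemma nn_integral_jump_kernel_mult:
  assumes I: "I \<in> sets borel" "emeasure lborel I < \<infinity>" "I \<subseteq> {0..}" and "0 \<le> a"
  shows "(\<integral>\<^sup>+e. ennreal (jump_kernel I a \<kappa> S e) * ennreal (jump_kernel I a \<kappa> S' e) \<partial>intensity \<nu>) =
    ennreal ((\<integral>y. y\<^sup>2 \<partial>\<nu>) * (a * overlap I S S'))"
proof -
  have "(\<integral>\<^sup>+e. ennreal (jump_kernel I a \<kappa> S e) * ennreal (jump_kernel I a \<kappa> S' e) \<partial>intensity \<nu>) =
      (\<integral>\<^sup>+e. indicator I (fst e) * (ennreal ((snd (snd e))\<^sup>2) *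
         of_bool (fst (snd e) \<le> a * jump_overlap \<kappa> S S' (fst e))) \<partial>intensity \<nu>)"
  proof (rule nn_integral_cong)
    fix e assume "e \<in> space (intensity \<nu>)"
    note y = space_intensityD[OF this]
    \<comment> \<open>An atom enters both kernels exactly when x is below the smaller threshold,
      which is again a threshold of the form that \<open>nn_integral_intensity\<close> handles; its
      mark then counts squared.\<close>
    have "fst (snd e) \<le> a * jump_overlap \<kappa> S S' (fst e) \<longleftrightarrow>
        fst (snd e) \<le> a * jump_overlap \<kappa> S S (fst e) \<and> fst (snd e) \<le> a * jump_overlap \<kappa> S' S' (fst e)"
      by (subst min_jump_overlap[OF assms(4) nonneg(3), symmetric]) (rule min.bounded_iff)
    then show "ennreal (jump_kernel I a \<kappa> S e) * ennreal (jump_kernel I a \<kappa> S' e) =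
        indicator I (fst e) * (ennreal ((snd (snd e))\<^sup>2) *
          of_bool (fst (snd e) \<le> a * jump_overlap \<kappa> S S' (fst e)))"
      using y unfolding jump_kernel_def
      by (cases "fst e \<in> I"; cases "fst (snd e) \<le> a * jump_overlap \<kappa> S S (fst e)";
        cases "fst (snd e) \<le> a * jump_overlap \<kappa> S' S' (fst e)")
        (simp_all add: power2_eq_square ennreal_mult)
  qed
  also have "\<dots> = (\<integral>\<^sup>+y. ennreal (y\<^sup>2) \<partial>\<nu>) * ennreal (a * overlap I S S')"
    by (subst nn_integral_intensity[OF prob_mark _ _ _ I(1,3)])
      (simp_all add: nn_integral_overlap[OF I(1,2) assms(4)] assms(4) jump_overlap_nonneg)
  also have "(\<integral>\<^sup>+y. ennreal (y\<^sup>2) \<partial>\<nu>) = ennreal (\<integral>y. y\<^sup>2 \<partial>\<nu>)"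
    by (intro nn_integral_eq_integral mark_square) simp
  finally show ?thesis
    by (simp only: ennreal_mult''[OF mult_nonneg_nonneg[OF assms(4) overlap_nonneg]])
qed

text \<open>The premise that equal drivers have equal base rates reflects that a driver has one base
  rate for all maturities; the overlap formula for two kernels applies to that case.\<close>

lemma jumps_product_moment:
  assumes I: "I \<in> sets borel" "emeasure lborel I < \<infinity>" "I \<subseteq> {0..}" and a: "0 \<le> a" "0 \<le> b"
    and d: "d \<in> drivers M" "e \<in> drivers M" and eq: "d = e \<Longrightarrow> a = b"
  shows "has_bochner_integral P (\<lambda>w. jumps I a S d w * jumps I b S' e w)
    (of_bool (d = e) * ((\<integral>y. y\<^sup>2 \<partial>\<nu>) * (a * overlap I S S')) +
     ((\<integral>y. y \<partial>\<nu>) * (a * overlap I S S)) * ((\<integral>y. y \<partial>\<nu>) * (b * overlap I S' S')))"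
  unfolding jumps_def
proof (rule poisson_random_measures_product_moment[OF poisson independent d])
  have "0 \<le> (\<integral>y. y \<partial>\<nu>)"
    using mark_nonneg by (intro integral_nonneg_AE AE_I2) auto
  then show "0 \<le> (\<integral>y. y \<partial>\<nu>) * (a * overlap I S S)" "0 \<le> (\<integral>y. y \<partial>\<nu>) * (b * overlap I S' S')"
    using a overlap_nonneg by simp_all
  show "0 \<le> (\<integral>y. y\<^sup>2 \<partial>\<nu>) * (a * overlap I S S')"
    using a overlap_nonneg by simp
  show "d = e \<Longrightarrow> (\<integral>\<^sup>+e. ennreal (jump_kernel I a \<kappa> S e) * ennreal (jump_kernel I b \<kappa> S' e) \<partial>intensity \<nu>) =
    ennreal ((\<integral>y. y\<^sup>2 \<partial>\<nu>) * (a * overlap I S S'))"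
    using eq nn_integral_jump_kernel_mult[OF I a(1)] by simp
qed (use I nn_integral_jump_kernel[OF I a(1)] nn_integral_jump_kernel[OF I a(2)] in simp_all)

section \<open>Jump integrals and their increments\<close>

lemma sets_N: "d \<in> drivers M \<Longrightarrow> w \<in> space P \<Longrightarrow> sets (N d w) = sets (intensity \<nu>)"
  using poisson_random_measureD(1)[OF poisson] by (simp add: random_measure_def)

text \<open>The kernel is nonnegative on the space of \<open>N d w\<close>. When the integral is
  infinite, both the Bochner integral and \<open>enn2real\<close> give 0, so the equality holds at
  every \<open>w\<close>.\<close>

lemma jump_integral_eq_jumps:
  assumes d: "d \<in> drivers M" and w: "w \<in> space P"
  shows "jump_integral (N d w) a \<kappa> S t = jumps {0<..t} a S d w"
  unfolding jump_integral_eq jumps_def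
proof (rule integral_eq_nn_integral)
  show "jump_kernel {0<..t} a \<kappa> S \<in> borel_measurable (N d w)"
    unfolding measurable_cong_sets[OF sets_N[OF d w] refl] by simp
  show "AE e in N d w. 0 \<le> jump_kernel {0<..t} a \<kappa> S e"
    using jump_kernel_nonneg sets_eq_imp_space_eq[OF sets_N[OF d w]] by (intro AE_I2) simp
qed

lemma measurable_jumps:
  assumes "d \<in> drivers M" "I \<in> sets borel"
  shows "jumps I a S d \<in> borel_measurable P"
proof -
  note assms(2)[measurable]
  show ?thesis
    unfolding jumps_def[abs_def]
    by (intro borel_measurable_enn2real poisson_random_measure_nn_integral(1)[OF poisson[OF assms(1)]]) simp
qed

lemma measurable_jump_integral [measurable]:
  assumes "d \<in> drivers M"
  shows "(\<lambda>w. jump_integral (N d w) a \<kappa> S t) \<in> borel_measurable P"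
  using measurable_jumps[OF assms, of "{0<..t}" a S] jump_integral_eq_jumps[OF assms]
  by (simp cong: measurable_cong)

text \<open>The kernel splits over \<open>{0<..t}\<close> and \<open>{t<..t'}\<close>. This sum
  passes through \<open>enn2real\<close> where both pieces are finite, which their finite means
  guarantee outside a null set.\<close>

lemma AE_jump_integral_diff:
  assumes d: "d \<in> drivers M" and t: "0 \<le> t" "t \<le> t'" and a: "0 \<le> a"
  shows "AE w in P. jump_integral (N d w) a \<kappa> S t' - jump_integral (N d w) a \<kappa> S t = jumps {t<..t'} a S d w"
proof -
  let ?F = "\<lambda>I w. \<integral>\<^sup>+e. ennreal (jump_kernel I a \<kappa> S e) \<partial>N d w"
  have finite: "AE w in P. ?F I w \<noteq> \<infinity>"
    if "I \<in> sets borel" "emeasure lborel I < \<infinity>" "I \<subseteq> {0..}" for I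
    using that by (intro AE_poisson_random_measure_nn_integral_finite[OF poisson[OF d]])
      (simp_all add: nn_integral_jump_kernel a)
  have "AE w in P. ?F {0<..t} w \<noteq> \<infinity>" "AE w in P. ?F {t<..t'} w \<noteq> \<infinity>"
    by (rule finite; use t in force)+
  then show ?thesis
    using AE_space
  proof eventually_elim
    case (elim w)
    have meas: "(\<lambda>e. ennreal (jump_kernel I a \<kappa> S e)) \<in> borel_measurable (N d w)" if "I \<in> sets borel" for I
      unfolding measurable_cong_sets[OF sets_N[OF d elim(3)] refl] using that by simp
    have "?F {0<..t'} w = (\<integral>\<^sup>+e. ennreal (jump_kernel {0<..t} a \<kappa> S e) + ennreal (jump_kernel {t<..t'} a \<kappa> S e) \<partial>N d w)"
    proof (rule nn_integral_cong)
      fix e assume "e \<in> space (N d w)"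
      then have e: "e \<in> space (intensity \<nu>)"
        using sets_eq_imp_space_eq[OF sets_N[OF d elim(3)]] by simp
      have "jump_kernel {0<..t'} a \<kappa> S e = jump_kernel {0<..t} a \<kappa> S e + jump_kernel {t<..t'} a \<kappa> S e"
        using t unfolding jump_kernel_def
        by (cases "fst e \<le> t"; cases "0 < fst e"; cases "fst e \<le> t'") simp_all
      then show "ennreal (jump_kernel {0<..t'} a \<kappa> S e) =
          ennreal (jump_kernel {0<..t} a \<kappa> S e) + ennreal (jump_kernel {t<..t'} a \<kappa> S e)"
        by (simp add: jump_kernel_nonneg[OF e])
    qed
    also have "\<dots> = ?F {0<..t} w + ?F {t<..t'} w"
      by (intro nn_integral_add meas) simp_all
    finally have "jumps {0<..t'} a S d w = jumps {0<..t} a S d w + jumps {t<..t'} a S d w"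
      using elim(1,2) by (simp add: jumps_def enn2real_plus top.not_eq_extremum)
    then show ?case
      by (simp add: jump_integral_eq_jumps[OF d elim(3)])
  qed
qed

section \<open>Second moments of price increments\<close>

text \<open>For \<open>I = {t<..t'}\<close> with 0 \<le> t \<le> t' this is almost surely the
  increment of \<open>price_side\<close> over that interval.\<close>

definition side_jumps :: "real set \<Rightarrow> side \<Rightarrow> nat \<Rightarrow> 'w \<Rightarrow> real" where
  "side_jumps I h m w = jumps I \<mu> (T m) (Specific h m) w + jumps I \<mu>c (T m) (Common h) w"

lemma drivers_mem: "Common h \<in> drivers M" "m \<in> {1..M} \<Longrightarrow> Specific h m \<in> drivers M"
  by (auto simp: drivers_def)

lemma measurable_price [measurable]:
  assumes "m \<in> {1..M}"
  shows "price \<mu> \<mu>c \<kappa> T f0 N m t \<in> borel_measurable P"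
  unfolding price_def[abs_def] price_side_def[abs_def]
  using measurable_jump_integral[OF drivers_mem(1)] measurable_jump_integral[OF drivers_mem(2)[OF assms]]
  by (intro borel_measurable_add borel_measurable_diff borel_measurable_const)

lemma AE_price_diff:
  assumes m: "m \<in> {1..M}" and t: "0 \<le> t" "t \<le> t'"
  shows "AE w in P. price \<mu> \<mu>c \<kappa> T f0 N m t' w - price \<mu> \<mu>c \<kappa> T f0 N m t w =
    side_jumps {t<..t'} Up m w - side_jumps {t<..t'} Down m w"
proof -
  note A = AE_jump_integral_diff[OF drivers_mem(2)[OF m] t nonneg(1), of _ "T m"]
    AE_jump_integral_diff[OF drivers_mem(1) t nonneg(2), of _ "T m"]
  show ?thesis
    using A(1)[of Up] A(1)[of Down] A(2)[of Up] A(2)[of Down]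
    by eventually_elim (simp add: price_def price_side_def side_jumps_def)
qed

text \<open>The expectation of \<open>side_jumps I h m\<close> for the bounded time sets in use. It
  does not depend on the side \<open>h\<close>, which is why products of means cancel between up and
  down.\<close>

definition side_mean :: "real set \<Rightarrow> nat \<Rightarrow> real" where
  "side_mean I m = (\<integral>y. y \<partial>\<nu>) * ((\<mu> + \<mu>c) * overlap I (T m) (T m))"

text \<open>Expanding gives four pairs of drivers. The specific ones coincide when h = h' and k = l,
  the common ones when h = h', and a specific driver is never a common one; this yields the factor
  \<mu>c + \<mu> \<delta>_kl.\<close>

lemma side_jumps_product_moment:
  assumes I: "I \<in> sets borel" "emeasure lborel I < \<infinity>" "I \<subseteq> {0..}" and k: "k \<in> {1..M}" and l: "l \<in> {1..M}"
  shows "has_bochner_integral P (\<lambda>w. side_jumps I h k w * side_jumps I h' l w)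
    (of_bool (h = h') * ((\<integral>y. y\<^sup>2 \<partial>\<nu>) * ((\<mu>c + \<mu> * of_bool (k = l)) * overlap I (T k) (T l))) +
     side_mean I k * side_mean I l)"
proof -
  \<comment> \<open>Reading the base rate off the driver lets one statement serve all four pairs and
    makes equal drivers have equal rates automatically.\<close>
  let ?J = "\<lambda>d m. jumps I (case d of Common _ \<Rightarrow> \<mu>c | Specific _ _ \<Rightarrow> \<mu>) (T m) d"
  have J: "has_bochner_integral P (\<lambda>w. ?J d k w * ?J e l w)
    (of_bool (d = e) * ((\<integral>y. y\<^sup>2 \<partial>\<nu>) * ((case d of Common _ \<Rightarrow> \<mu>c | Specific _ _ \<Rightarrow> \<mu>) * overlap I (T k) (T l))) +
     ((\<integral>y. y \<partial>\<nu>) * ((case d of Common _ \<Rightarrow> \<mu>c | Specific _ _ \<Rightarrow> \<mu>) * overlap I (T k) (T k))) *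
     ((\<integral>y. y \<partial>\<nu>) * ((case e of Common _ \<Rightarrow> \<mu>c | Specific _ _ \<Rightarrow> \<mu>) * overlap I (T l) (T l))))"
    if "d \<in> drivers M" "e \<in> drivers M" for d e
    by (rule jumps_product_moment[OF I _ _ that]) (simp_all add: nonneg split: driver.split)
  note C = drivers_mem(1)[of h] drivers_mem(1)[of h']
    and S = drivers_mem(2)[OF k, of h] drivers_mem(2)[OF l, of h']
  show ?thesis
  proof (rule has_bochner_integral_transfer[OF has_bochner_integral_add[OF
      has_bochner_integral_add[OF J[OF S(1) S(2)] J[OF S(1) C(2)]]
      has_bochner_integral_add[OF J[OF C(1) S(2)] J[OF C(1) C(2)]]]])
  qed (cases "h = h'"; cases "k = l"; simp add: side_jumps_def side_mean_def algebra_simps)+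
qed

text \<open>The product is the sum of the two like-sided products minus the sum of the two mixed
  ones. All four carry the same product of means, which cancels; the like-sided ones each leave a
  covariance, hence the factor 2.\<close>

lemma side_jumps_diff_product_moment:
  assumes I: "I \<in> sets borel" "emeasure lborel I < \<infinity>" "I \<subseteq> {0..}" and k: "k \<in> {1..M}" and l: "l \<in> {1..M}"
  shows "has_bochner_integral P
    (\<lambda>w. (side_jumps I Up k w - side_jumps I Down k w) * (side_jumps I Up l w - side_jumps I Down l w))
    (2 * (\<integral>y. y\<^sup>2 \<partial>\<nu>) * ((\<mu>c + \<mu> * of_bool (k = l)) * overlap I (T k) (T l)))"
proof -
  define c where "c = (\<integral>y. y\<^sup>2 \<partial>\<nu>) * ((\<mu>c + \<mu> * of_bool (k = l)) * overlap I (T k) (T l))"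
  note X = side_jumps_product_moment[OF I k l, folded c_def]
  show ?thesis
    unfolding mult.assoc c_def[symmetric]
    by (rule has_bochner_integral_transfer[OF has_bochner_integral_diff[OF
      has_bochner_integral_add[OF X[of Up Up] X[of Down Down]]
      has_bochner_integral_add[OF X[of Up Down] X[of Down Up]]]])
      (simp_all add: algebra_simps)
qed

lemma price_diff_product_moment:
  assumes k: "k \<in> {1..M}" and l: "l \<in> {1..M}" and t: "0 \<le> t" "t \<le> t'"
  shows "has_bochner_integral P
    (\<lambda>w. (price \<mu> \<mu>c \<kappa> T f0 N k t' w - price \<mu> \<mu>c \<kappa> T f0 N k t w) *
      (price \<mu> \<mu>c \<kappa> T f0 N l t' w - price \<mu> \<mu>c \<kappa> T f0 N l t w))
    (2 * (\<integral>y. y\<^sup>2 \<partial>\<nu>) * ((\<mu>c + \<mu> * of_bool (k = l)) * overlap {t<..t'} (T k) (T l)))"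
proof -
  have I: "{t<..t'} \<in> sets borel" "emeasure lborel {t<..t'} < \<infinity>" "{t<..t'} \<subseteq> {0..}"
    using t by auto
  have X: "side_jumps {t<..t'} h m \<in> borel_measurable P" if "m \<in> {1..M}" for h m
    unfolding side_jumps_def[abs_def]
    by (intro borel_measurable_add measurable_jumps drivers_mem that I(1))
  have "AE w in P. (price \<mu> \<mu>c \<kappa> T f0 N k t' w - price \<mu> \<mu>c \<kappa> T f0 N k t w) *
      (price \<mu> \<mu>c \<kappa> T f0 N l t' w - price \<mu> \<mu>c \<kappa> T f0 N l t w) =
      (side_jumps {t<..t'} Up k w - side_jumps {t<..t'} Down k w) *
      (side_jumps {t<..t'} Up l w - side_jumps {t<..t'} Down l w)"
    using AE_price_diff[OF k t] AE_price_diff[OF l t] by eventually_elim simp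
  then show ?thesis
    using side_jumps_diff_product_moment[OF I k l] X[OF k] X[OF l] measurable_price[OF k] measurable_price[OF l]
    by (subst has_bochner_integral_cong_AE) (auto intro!: borel_measurable_times borel_measurable_diff)
qed

section \<open>Summation over the time grid\<close>

lemma sum_overlap:
  assumes "0 < \<Delta>"
  shows "(\<Sum>i = 1..n. overlap {(real i - 1) * \<Delta><..real i * \<Delta>} S S') = overlap {0..real n * \<Delta>} S S'"
proof (induction n)
  case 0
  \<comment> \<open>The half-open cells never cover time 0, whereas the closed interval does; the
    difference is one Lebesgue-null point.\<close>
  have "overlap {0..0} S S' = 0"
    unfolding overlap_def set_lebesgue_integral_def
    by (rule integral_eq_zero_AE) (use AE_lborel_singleton[of 0] in \<open>auto elim!: eventually_mono\<close>)
  then show ?case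
    by simp
next
  case (Suc n)
  have le: "real n * \<Delta> \<le> real (Suc n) * \<Delta>"
    using assms by (simp add: mult_right_mono)
  have 0: "0 \<le> real n * \<Delta>"
    using assms by simp
  have "overlap {0..real (Suc n) * \<Delta>} S S' = overlap ({0..real n * \<Delta>} \<union> {real n * \<Delta><..real (Suc n) * \<Delta>}) S S'"
    using le 0 by (simp only: ivl_disj_un)
  also have "\<dots> = overlap {0..real n * \<Delta>} S S' + overlap {real n * \<Delta><..real (Suc n) * \<Delta>} S S'"
    unfolding overlap_def
    by (intro set_integral_Un set_integrable_jump_overlap nonneg(3))
      (use le 0 in \<open>simp_all add: disjoint_iff\<close>)
  finally show ?case
    using Suc by simp
qed

lemma quad_covariation_expectation:
  assumes k: "k \<in> {1..M}" and l: "l \<in> {1..M}" and "0 < \<Delta>"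
  shows "has_bochner_integral P (quad_covariation (price \<mu> \<mu>c \<kappa> T f0 N) k l \<Delta> \<tau>)
    (2 * (\<integral>y. y\<^sup>2 \<partial>\<nu>) *
      ((\<mu>c + \<mu> * of_bool (k = l)) * overlap {0..real (nat \<lfloor>\<tau> / \<Delta>\<rfloor>) * \<Delta>} (T k) (T l)))"
proof -
  have "has_bochner_integral P (quad_covariation (price \<mu> \<mu>c \<kappa> T f0 N) k l \<Delta> \<tau>)
    (\<Sum>i = 1..nat \<lfloor>\<tau> / \<Delta>\<rfloor>. 2 * (\<integral>y. y\<^sup>2 \<partial>\<nu>) *
      ((\<mu>c + \<mu> * of_bool (k = l)) * overlap {(real i - 1) * \<Delta><..real i * \<Delta>} (T k) (T l)))"
    unfolding quad_covariation_def[abs_def]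
    by (intro has_bochner_integral_sum price_diff_product_moment k l)
      (use assms(3) in \<open>auto intro: mult_right_mono\<close>)
  then show ?thesis
    by (simp only: sum_distrib_left[symmetric] sum_overlap[OF assms(3)])
qed

end

text \<open>Integrability belongs to the conclusion because the Bochner integral of a non-integrable
  function is 0 by convention, so the value alone would not assert that the expectation
  exists.\<close>

theorem proposition3:
  fixes P :: "'w measure" and \<nu> :: "real measure" and K :: "real set"
    and N :: "driver \<Rightarrow> 'w \<Rightarrow> (real \<times> real \<times> real) measure"
    and M k l :: nat and T f0 :: "nat \<Rightarrow> real"
    and \<mu> \<mu>c \<kappa> \<Delta> \<tau> :: real
  assumes "M \<ge> 1" and "0 < T 1" and "strict_mono_on {1..M} T"
    and "prob_space \<nu>" and "space \<nu> = K" and "K \<subseteq> {0..}"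
    and "emeasure \<nu> {0} = 0" and "integrable \<nu> (\<lambda>y. y\<^sup>2)"
    and "prob_space P"
    and "\<forall>d\<in>drivers M. poisson_random_measure P (intensity \<nu>) (N d)"
    and "independent_random_measures P (intensity \<nu>) N (drivers M)"
    and "\<mu> \<ge> 0" and "\<mu>c \<ge> 0" and "\<kappa> \<ge> 0"
    and "k \<in> {1..M}" and "l \<in> {1..M}"
    and "0 < \<Delta>" and "\<Delta> < \<tau>" and "\<tau> \<le> T M"
  shows "integrable P (quad_covariation (price \<mu> \<mu>c \<kappa> T f0 N) k l \<Delta> \<tau>) \<and>
    (\<integral>w. quad_covariation (price \<mu> \<mu>c \<kappa> T f0 N) k l \<Delta> \<tau> w \<partial>P) =
      2 * (\<integral>y. y\<^sup>2 \<partial>\<nu>) *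
      (LINT s:{0..\<Delta> * \<lfloor>\<tau> / \<Delta>\<rfloor>}|lborel.
         (\<mu>c + \<mu> * of_bool (k = l)) * exp (- \<kappa> * (max (T k) (T l) - s)) *
         of_bool (s \<le> min (T k) (T l)))"
proof -
  interpret prob_space P by fact
  interpret jump_driven_curve P \<nu> N M T f0 \<mu> \<mu>c \<kappa>
    by (intro jump_driven_curve.intro jump_driven_curve_axioms.intro) (use assms(4-6,8-14) in simp_all)
  \<comment> \<open>Since \<tau> / \<Delta> is positive, its floor is nonnegative and the conversion
    by \<open>nat\<close> does not truncate.\<close>
  have "real (nat \<lfloor>\<tau> / \<Delta>\<rfloor>) * \<Delta> = \<Delta> * \<lfloor>\<tau> / \<Delta>\<rfloor>"
    using assms(17,18) by simp
  moreover have "(\<mu>c + \<mu> * of_bool (k = l)) * overlap I (T k) (T l) =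
      (LINT s:I|lborel. (\<mu>c + \<mu> * of_bool (k = l)) * exp (- \<kappa> * (max (T k) (T l) - s)) *
         of_bool (s \<le> min (T k) (T l)))" for I
    unfolding overlap_def by (subst set_integral_mult_right[symmetric]) (simp only: jump_overlap_def mult.assoc)
  ultimately show ?thesis
    using quad_covariation_expectation[OF assms(15-17), of \<tau>]
    by (simp only: has_bochner_integral_iff)
qed

end
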